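(* For every integer $d\ge 3$ and all positive integers $n_1,\ldots,n_d$, the grid graph $P_{n_1}\square P_{n_2}\square\cdots\square P_{n_d}$ is a $(d-1)$-interval-PCG.
   Context: All graphs are finite, simple, undirected, with nonempty vertex set. A weighted tree is a finite tree with strictly positive real edge weights. For a weighted tree $T$ and vertices $x,y$ of $T$, $d_T(x,y)$ is the total weight of the unique $x$–$y$ path, and $L(T)$ is the set of leaves of $T$ (the vertex of a one-vertex tree counts as a leaf). Grid graph: for positive integers $n_1,\ldots,n_d$, the graph $P_{n_1}\square\cdots\square P_{n_d}$ has vertex set $\{(x_1,\ldots,x_d)\in\mathbb{Z}^d: 0\le x_i\le n_i-1 \text{ for every } i\in\{1,\ldots,d\}\}$; two vertices are adjacent if and only if they differ by $1$ in exactly one coordinate and agree in every other coordinate. $k$-interval-PCG ($k\ge 1$): a graph $G=(V,E)$ is a $k$-interval-PCG if there exist a weighted tree $T$, a bijection $\zeta:V\to L(T)$, and pairwise disjoint closed intervals $I_1,\ldots,I_k$ such that for every pair of distinct vertices $u,v\in V$, $uv\in E$ if and only if $d_T(\zeta(u),\zeta(v))\in\bigcup_{j=1}^k I_j$. *)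

theory Defs
  imports
    Complex_Main
    "HOL-Library.FuncSet"
    "HOL-Library.Disjoint_Sets"
    "Graph_Theory.Pair_Digraph"
    "Graph_Theory.Digraph_Component"
    "Graph_Theory.Weighted_Graph"
begin

text \<open>
  A finite simple undirected graph is a \<^locale>\<open>pair_graph\<close>: every edge \<open>xy\<close> is represented by
  the two arcs \<open>(x, y)\<close> and \<open>(y, x)\<close>.  Under this encoding \<open>x, y, x\<close> counts as a cycle in
  Graph_Theory, so \<^const>\<open>Digraph_Component.tree\<close> rules out every edge and cannot be used;
  the cycles of the undirected graph are the cycles of length at least 3.
  \<^const>\<open>Digraph_Component.connected\<close> includes nonemptiness.
\<close>

locale weighted_tree = pair_graph T for T :: "'b pair_pre_digraph" +
  fixes w :: "('b \<times> 'b) weight_fun"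
  assumes tree_connected: "Digraph_Component.connected (with_proj T)"
    and tree_acyclic: "\<not> (\<exists>c. cycle c \<and> 3 \<le> length c)"
    and weight_sym: "(x, y) \<in> parcs T \<Longrightarrow> w (y, x) = w (x, y)"
    and weight_pos: "(x, y) \<in> parcs T \<Longrightarrow> 0 < w (x, y)"
begin

definition tree_dist :: "'b \<Rightarrow> 'b \<Rightarrow> real" where
  "tree_dist x y = awalk_cost w (THE p. apath x p y)"

end

definition tree_leaves :: "'b pair_pre_digraph \<Rightarrow> 'b set" where
  "tree_leaves T = {x \<in> pverts T. out_degree (with_proj T) x = 1 \<or> pverts T = {x}}"

text \<open>
  Trees are finite, so taking their vertices in \<^typ>\<open>nat\<close> is no restriction.
  The \<open>j\<close>-th interval is \<open>[a j, b j]\<close>, nonempty and possibly a single point.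
\<close>

definition interval_PCG :: "nat \<Rightarrow> 'a pair_pre_digraph \<Rightarrow> bool" where
  "interval_PCG k G \<longleftrightarrow>
     1 \<le> k \<and> pair_graph G \<and> pverts G \<noteq> {} \<and>
     (\<exists>(T :: nat pair_pre_digraph) w \<zeta> (a :: nat \<Rightarrow> real) b.
        weighted_tree T w \<and>
        bij_betw \<zeta> (pverts G) (tree_leaves T) \<and>
        (\<forall>j\<in>{1..k}. a j \<le> b j) \<and>
        disjoint_family_on (\<lambda>j. {a j..b j}) {1..k} \<and>
        (\<forall>u\<in>pverts G. \<forall>v\<in>pverts G. u \<noteq> v \<longrightarrow>
           ((u, v) \<in> parcs G \<longleftrightarrow>
            weighted_tree.tree_dist T w (\<zeta> u) (\<zeta> v) \<in> (\<Union>j\<in>{1..k}. {a j..b j}))))"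

text \<open>
  A point of \<open>\<int>\<^sup>d\<close> is a function on \<open>{1..d}\<close>, extended by \<^const>\<open>undefined\<close> (\<^const>\<open>PiE\<close>);
  only the values \<open>n 1, \<dots>, n d\<close> matter.
\<close>

definition grid_verts :: "nat \<Rightarrow> (nat \<Rightarrow> nat) \<Rightarrow> (nat \<Rightarrow> int) set" where
  "grid_verts d n = (\<Pi>\<^sub>E i\<in>{1..d}. {0..int (n i) - 1})"

definition grid_graph :: "nat \<Rightarrow> (nat \<Rightarrow> nat) \<Rightarrow> (nat \<Rightarrow> int) pair_pre_digraph" where
  "grid_graph d n =
     \<lparr> pverts = grid_verts d n,
       parcs = {(x, y). x \<in> grid_verts d n \<and> y \<in> grid_verts d n \<and>
                  (\<exists>i\<in>{1..d}. \<bar>x i - y i\<bar> = 1 \<and> (\<forall>j\<in>{1..d} - {i}. x j = y j))} \<rparr>"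

end

theory Submission
  imports Defs
begin

text \<open>
  Attach one pendant leaf to the spine of a caterpillar at integer position \<open>L x\<close> for every vertex
  \<open>x\<close>; with unit weights two leaves are at distance \<open>\<bar>L x - L y\<bar> + 2\<close>.  Taking \<open>L\<close> linear with weights
  \<open>N, N + 1, N\<^sup>3, N\<^sup>4, \<dots>, N\<^sup>d\<close> for a large \<open>N\<close>, the value \<open>L x - L y\<close> determines \<open>x - y\<close>, so \<open>xy\<close> is
  an edge iff \<open>\<bar>L x - L y\<bar>\<close> is one of these \<open>d\<close> weights.  The consecutive integers \<open>N\<close> and \<open>N + 1\<close>
  share one interval and each other weight is an interval of its own: \<open>d - 1\<close> intervals in total.
\<close>

section \<open>Trees given by a parent function on the naturals\<close>

text \<open>Numbering every vertex above its parent lets the order on the naturals replace depth: an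
  arc leads towards the root exactly when it decreases the number.\<close>

locale parent_tree = pair_graph T for T :: "nat pair_pre_digraph" +
  fixes par :: "nat \<Rightarrow> nat"
  assumes root: "0 \<in> pverts T"
    and par: "x \<in> pverts T \<Longrightarrow> 0 < x \<Longrightarrow> par x \<in> pverts T \<and> par x < x"
    and arc_iff: "(x, y) \<in> parcs T \<longleftrightarrow> x \<in> pverts T \<and> y \<in> pverts T \<and>
      (y < x \<and> y = par x \<or> x < y \<and> x = par y)"
begin

text \<open>A path that has once moved away from the root can never turn back, since it would have to
  reuse the arc to the parent.\<close>

lemma apath_ascend:
  assumes "apath x ((x, c) # p) y" and "x < c"
  shows "x < y"
  using assms
proof (induction p arbitrary: x c)
  case Nil
  then show ?case by (auto simp: apath_simps)
next
  case (Cons e p)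
  obtain c' where e: "e = (c, c')"
    using Cons.prems(1) by (cases e) (auto simp: apath_simps)
  have *: "apath c ((c, c') # p) y" "x \<noteq> c'" "(c, c') \<in> parcs T" "(x, c) \<in> parcs T"
    using Cons.prems(1) hd_in_awalk_verts(2)[of c' p y] by (auto simp: e apath_simps)
  then have "c < c'"
    using \<open>x < c\<close> by (auto simp: arc_iff)
  with Cons.IH * Cons.prems(2) show ?case by force
qed

text \<open>A first arc away from the root would force the path to end above \<open>x\<close>, by
  \<open>apath_ascend\<close>; so the first arc is the one to the parent.\<close>

lemma apath_descend:
  assumes "apath x p y" and "y < x"
  obtains q where "p = (x, par x) # q" and "apath (par x) q y"
proof (cases p)
  case Nil
  with assms show ?thesis by (auto simp: apath_simps)
next
  case (Cons e q)
  obtain c where e: "e = (x, c)"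
    using assms(1) Cons by (cases e) (auto simp: apath_simps)
  have "\<not> x < c"
    using apath_ascend[of x c q y] assms Cons e by auto
  then have "c = par x"
    using assms(1) Cons e by (auto simp: apath_simps arc_iff)
  then show ?thesis
    using that assms(1) Cons e by (auto simp: apath_simps)
qed

text \<open>One of a path and its reversal starts at the larger end and hence begins with the arc to
  the parent. Up to symmetry, every path is thus built by prepending such arcs.\<close>

lemma apath_induct [consumes 1, case_names refl sym step]:
  assumes "apath x p y"
    and refl: "\<And>x. P x [] x"
    and sym: "\<And>x p y. P y (rev_path p) x \<Longrightarrow> P x p y"
    and step: "\<And>x p y. y < x \<Longrightarrow> apath (par x) p y \<Longrightarrow> P (par x) p y \<Longrightarrow> P x ((x, par x) # p) y"
  shows "P x p y"
  using assms(1)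
proof (induction "length p" arbitrary: x p y rule: less_induct)
  case less
  \<comment> \<open>\<open>down\<close> is applied both to the given path and to its reversal. The
    reversal is not shorter, so the induction hypothesis cannot serve it directly; \<open>p0\<close>
    fixes the common length, and the hypothesis is used only for the tail left after the first
    arc.\<close>
  have down: "P x p y" if "apath x p y" "y < x" "length p = length p0" and
    IH: "\<And>x q y. length q < length p0 \<Longrightarrow> apath x q y \<Longrightarrow> P x q y" for x p y p0
    using that step by (metis apath_descend length_Cons lessI)
  have len: "length (rev_path p) = length p" for p :: "(nat \<times> nat) list"
    by (induction p) auto
  consider "x = y" | "y < x" | "x < y" by linarith
  then show ?case
  proof cases
    case 1
    then show ?thesis
      using less.prems refl apath_nonempty_ends by (cases "p = []") auto
  next
    case 2
    show ?thesis by (rule down[OF less.prems 2 HOL.refl less.hyps])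
  next
    case 3
    have "apath y (rev_path p) x"
      using less.prems by simp
    then have "P y (rev_path p) x"
      by (rule down[OF _ 3 len less.hyps])
    then show ?thesis by (rule sym)
  qed
qed

text \<open>Two paths from \<open>x\<close> to a smaller \<open>y\<close> share their first arc, the
  one to the parent, so it suffices to compare their tails.\<close>

lemma apath_unique:
  assumes "apath x p y" and "apath x q y"
  shows "p = q"
  using assms
proof (induction arbitrary: q rule: apath_induct)
  case (refl x)
  then show ?case by (metis apath_nonempty_ends)
next
  case (sym x p y)
  then show ?case by (metis apath_rev_path rev_path_eq)
next
  case (step x p y)
  then show ?case by (metis apath_descend)
qed

text \<open>Allows a closed formula \<open>D\<close> for the distance to be verified by its
  recursion along parents, without exhibiting any path.\<close>

lemma length_apath_eq:
  assumes "apath x p y"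
    and "\<And>x. D x x = 0" and "\<And>x y. D x y = D y x"
    and "\<And>x y. y < x \<Longrightarrow> D x y = Suc (D (par x) y)"
  shows "length p = D x y"
  using assms(1)
proof (induction rule: apath_induct)
  case (sym x p y)
  moreover have "length (rev_path p) = length p"
    by (induction p) auto
  ultimately show ?case using assms(3) by metis
next
  case (step x p y)
  then show ?case using assms(4) by simp
qed (simp add: assms(2))

lemma reachable_root: "x \<in> pverts T \<Longrightarrow> x \<rightarrow>\<^sup>*\<^bsub>with_proj T\<^esub> 0"
proof (induction x rule: less_induct)
  case (less x)
  show ?case
  proof (cases "x = 0")
    case True
    then show ?thesis using less.prems by simp
  next
    case False
    then have "(x, par x) \<in> parcs T" "par x \<in> pverts T" "par x < x"
      using par[OF less.prems] less.prems by (auto simp: arc_iff)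
    with less.IH show ?thesis
      by (meson adj_reachable_trans with_proj_simps(3))
  qed
qed

lemma reachable_all:
  assumes "x \<in> pverts T" and "y \<in> pverts T"
  shows "x \<rightarrow>\<^sup>*\<^bsub>with_proj T\<^esub> y"
  using assms reachable_root symmetric_reachable[OF sym_arcs] reachable_trans by blast

lemma apath_exists:
  assumes "x \<in> pverts T" and "y \<in> pverts T"
  obtains p where "apath x p y"
  using reachable_all[OF assms] reachable_apath by blast

lemma parent_tree_connected: "Digraph_Component.connected (with_proj T)"
proof (rule connectedI)
  show "pverts T \<noteq> {}"
    using root by auto
  show "x \<rightarrow>\<^sup>*\<^bsub>with_proj (mk_symmetric (with_proj T))\<^esub> y"
    if "x \<in> pverts T" "y \<in> pverts T" for x y
    using that reachable_all reachable_mk_symmetric_eq[OF sym_arcs] by simp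
qed

text \<open>What follows the first arc \<open>(u, v)\<close> of a cycle is a path from
  \<open>v\<close> back to \<open>u\<close>. By uniqueness it is the reversed arc alone, so the
  cycle has length 2.\<close>

lemma parent_tree_acyclic:
  assumes "cycle c"
  shows "length c < 3"
proof -
  obtain u where u: "awalk u c u" "distinct (tl (awalk_verts u c))" "c \<noteq> []"
    using assms unfolding cycle_def by blast
  then obtain v q where c: "c = (u, v) # q"
    by (cases c) (auto simp: awalk_Cons_iff)
  have arc: "(u, v) \<in> parcs T" and q: "apath v q u"
    using u by (auto simp: c apath_def awalk_Cons_iff)
  have "apath v [(v, u)] u"
    using arcs_symmetric[OF arc] no_loops'[OF arc]
    by (auto simp: apath_simps dest: wellformed')
  then have "q = [(v, u)]"
    using q by (rule apath_unique[symmetric])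
  then show ?thesis
    by (simp add: c)
qed

lemma weighted_tree_unit: "weighted_tree T (\<lambda>_. 1)"
  by unfold_locales (use parent_tree_connected parent_tree_acyclic in fastforce)+

lemma tree_dist_unit:
  assumes "x \<in> pverts T" and "y \<in> pverts T"
    and "\<And>x. D x x = 0" and "\<And>x y. D x y = D y x"
    and "\<And>x y. y < x \<Longrightarrow> D x y = Suc (D (par x) y)"
  shows "weighted_tree.tree_dist T (\<lambda>_. 1) x y = real (D x y)"
proof -
  interpret W: weighted_tree T "\<lambda>_. 1"
    by (rule weighted_tree_unit)
  obtain p where p: "apath x p y"
    using apath_exists assms(1,2) .
  then have "(THE p. apath x p y) = p"
    by (intro the_equality) (auto intro: apath_unique)
  moreover have "length p = D x y"
    using p assms(3-5) by (rule length_apath_eq)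
  ultimately show ?thesis
    by (simp add: W.tree_dist_def awalk_cost_def sum_list_triv)
qed

end

section \<open>Caterpillars: their leaves and leaf distances\<close>

text \<open>The spine vertex at position \<open>t\<close> is \<open>2 * t\<close> and the leaf attached to it is \<open>2 * t + 1\<close>.\<close>

definition caterpillar :: "nat set \<Rightarrow> nat pair_pre_digraph" where
  "caterpillar A =
     (let V = {x. if even x then x div 2 \<le> Max A else x div 2 \<in> A};
          par = (\<lambda>x. if even x then x - 2 else x - 1)
      in \<lparr> pverts = V, parcs = {(x, y). x \<in> V \<and> y \<in> V \<and>
             (y < x \<and> y = par x \<or> x < y \<and> x = par y)} \<rparr>)"

text \<open>Both ends of the spine carry a pendant leaf: position 0 by assumption, position
  \<open>Max A\<close> as a member of \<open>A\<close>. The set \<open>{0}\<close> is excluded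
  because its caterpillar is a single edge, whose spine vertex would itself be a leaf.\<close>

locale nontrivial_caterpillar =
  fixes A :: "nat set"
  assumes finite: "finite A" and zero_in: "0 \<in> A" and nontrivial: "A \<noteq> {0}"
begin

abbreviation "V \<equiv> {x. if even x then x div 2 \<le> Max A else x div 2 \<in> A}"
abbreviation "par \<equiv> (\<lambda>x::nat. if even x then x - 2 else x - 1)"

lemma pverts_eq: "pverts (caterpillar A) = V"
  by (simp add: caterpillar_def Let_def)

lemma parcs_eq: "parcs (caterpillar A) =
    {(x, y). x \<in> V \<and> y \<in> V \<and> (y < x \<and> y = par x \<or> x < y \<and> x = par y)}"
  by (simp add: caterpillar_def Let_def)

lemma Max_pos: "0 < Max A"
proof -
  obtain t where "t \<in> A" "0 < t"
    using zero_in nontrivial by auto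
  then show ?thesis
    using Max_ge[OF finite, of t] by linarith
qed

sublocale parent_tree "caterpillar A" par
proof unfold_locales
  have "V \<subseteq> {..2 * Max A + 1}"
  proof
    fix x assume "x \<in> V"
    then have "x div 2 \<le> Max A"
      using finite Max_ge by (auto split: if_splits)
    then show "x \<in> {..2 * Max A + 1}"
      by simp
  qed
  then have V: "finite V"
    by (rule finite_subset) simp
  show "finite (pverts (caterpillar A))"
    using V by (simp only: pverts_eq)
  have "parcs (caterpillar A) \<subseteq> V \<times> V"
    by (auto simp: parcs_eq)
  then show "finite (parcs (caterpillar A))"
    using V by (meson finite_SigmaI finite_subset)
  show "symmetric (with_proj (caterpillar A))"
    unfolding symmetric_def by (rule symI) (auto simp: parcs_eq)
  show "par x \<in> pverts (caterpillar A) \<and> par x < x"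
    if "x \<in> pverts (caterpillar A)" "0 < x" for x
  proof (cases "even x")
    case True
    with that have "(x - 2) div 2 \<le> Max A" "x - 2 < x" "even (x - 2)"
      by (auto simp: pverts_eq)
    with True show ?thesis
      by (simp add: pverts_eq)
  next
    case False
    with that have "x div 2 \<in> A"
      by (simp add: pverts_eq)
    moreover have "(x - 1) div 2 = x div 2" "even (x - 1)"
      using False by (auto elim: oddE)
    ultimately show ?thesis
      using False finite that Max_ge by (simp add: pverts_eq)
  qed
qed (use zero_in in \<open>auto simp: pverts_eq parcs_eq\<close>)

lemma tree_leaves_eq: "tree_leaves (caterpillar A) = (\<lambda>t. 2 * t + 1) ` A"
proof -
  have odd: "out_degree (with_proj (caterpillar A)) (2 * t + 1) = 1" if "t \<in> A" for t
  proof -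
    \<comment> \<open>\<open>par\<close> takes only even values.\<close>
    have no_child: "\<not> (2 * t + 1 < y \<and> 2 * t + 1 = par y)" for y
      by presburger
    have verts: "2 * t + 1 \<in> pverts (caterpillar A)" "2 * t \<in> pverts (caterpillar A)"
      using that finite by (simp_all add: pverts_eq)
    have par: "par (2 * t + 1) = 2 * t"
      by simp
    have arcs: "(2 * t + 1, y) \<in> parcs (caterpillar A) \<longleftrightarrow> y = 2 * t" for y
    proof
      assume "(2 * t + 1, y) \<in> parcs (caterpillar A)"
      then show "y = 2 * t"
        using no_child[of y] unfolding arc_iff par by blast
    next
      assume "y = 2 * t"
      then show "(2 * t + 1, y) \<in> parcs (caterpillar A)"
        using verts unfolding arc_iff par by simp
    qed
    have "e \<in> out_arcs (with_proj (caterpillar A)) (2 * t + 1) \<longleftrightarrow> e = (2 * t + 1, 2 * t)" for e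
      unfolding in_out_arcs_conv with_proj_simps by (cases e) (metis arcs fst_conv prod.inject)
    then have "out_arcs (with_proj (caterpillar A)) (2 * t + 1) = {(2 * t + 1, 2 * t)}"
      by blast
    then show ?thesis
      by (simp add: out_degree_def)
  qed
  have even: "out_degree (with_proj (caterpillar A)) (2 * t) \<noteq> 1" if "t \<le> Max A" for t
  proof -
    \<comment> \<open>Two distinct neighbours of the spine vertex \<open>2 * t\<close>, one on each
      side: the adjacent spine vertices, replaced at an end of the spine by the pendant leaf
      there.\<close>
    define x where "x = (if t = 0 then 1 else 2 * (t - 1))"
    define y where "y = (if t = Max A then 2 * t + 1 else 2 * (t + 1))"
    have "Max A \<in> A"
      using finite zero_in by (auto intro: Max_in)
    then have "{(2 * t, x), (2 * t, y)} \<subseteq> out_arcs (with_proj (caterpillar A)) (2 * t)"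
      using that zero_in Max_pos by (cases t) (auto simp: out_arcs_def parcs_eq x_def y_def)
    moreover have "x \<noteq> y"
      using Max_pos by (auto simp: x_def y_def)
    ultimately show ?thesis
      unfolding out_degree_def by (metis card_1_singletonE insert_subset prod.inject singletonD)
  qed
  have "2 * Max A \<in> V" "0 \<in> V"
    by auto
  then have "V \<noteq> {x}" for x
    using Max_pos by (metis mult_eq_0_iff not_gr_zero singletonD zero_neq_numeral)
  moreover have "(\<exists>t\<le>Max A. x = 2 * t) \<or> (\<exists>t\<in>A. x = 2 * t + 1)" if "x \<in> V" for x
    using that by (cases "even x") (auto elim!: evenE oddE)
  moreover have "2 * t + 1 \<in> V" if "t \<in> A" for t
    using that by simp
  ultimately show ?thesis
    using odd even unfolding tree_leaves_def pverts_eq by blast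
qed

lemma tree_dist_leaves:
  assumes "s \<in> A" and "t \<in> A" and "s \<noteq> t"
  shows "weighted_tree.tree_dist (caterpillar A) (\<lambda>_. 1) (2 * s + 1) (2 * t + 1) =
    \<bar>real s - real t\<bar> + 2"
proof -
  \<comment> \<open>The distance along the spine plus 1 for each end that is a pendant leaf. The
    diagonal is set apart because the formula would give 2 for a leaf and itself.\<close>
  define D :: "nat \<Rightarrow> nat \<Rightarrow> nat" where
    "D x y = (if x = y then 0 else nat \<bar>int (x div 2) - int (y div 2)\<bar> + x mod 2 + y mod 2)" for x y
  have "D x y = Suc (D (par x) y)" if "y < x" for x y
  proof (cases "even x")
    case True
    then obtain m where m: "x = 2 * m" ..
    obtain k r where y: "y = 2 * k + r" "r < 2"
      by (metis div_mult_mod_eq mod_less_divisor mult.commute zero_less_numeral)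
    \<comment> \<open>So the spine step from position \<open>m\<close> to \<open>m - 1\<close>
      brings it closer to position \<open>k\<close>.\<close>
    have "k < m"
      using m y that by auto
    then obtain l where "m = Suc (k + l)"
      using less_iff_Suc_add by blast
    then show ?thesis
      using y m by (auto simp: D_def)
  next
    case False
    then obtain m where m: "x = 2 * m + 1"
      by (auto elim: oddE)
    obtain k r where y: "y = 2 * k + r" "r < 2"
      by (metis div_mult_mod_eq mod_less_divisor mult.commute zero_less_numeral)
    show ?thesis
      using y m that by (cases "r = 0") (auto simp: D_def, presburger)
  qed
  moreover have "D x y = D y x" for x y
    by (simp add: D_def abs_minus_commute)
  ultimately have "weighted_tree.tree_dist (caterpillar A) (\<lambda>_. 1) (2 * s + 1) (2 * t + 1) =
      real (D (2 * s + 1) (2 * t + 1))"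
    using assms by (intro tree_dist_unit) (auto simp: D_def pverts_eq)
  also have "\<dots> = \<bar>real s - real t\<bar> + 2"
    using assms(3) by (simp add: D_def)
  finally show ?thesis .
qed

end

section \<open>From injective labels in the naturals to interval PCGs\<close>

text \<open>Serves graphs with a single vertex, for which the caterpillar would have two
  leaves.\<close>

lemma weighted_tree_singleton:
  "weighted_tree \<lparr>pverts = {x}, parcs = {}\<rparr> w" (is "weighted_tree ?T w")
proof -
  interpret pair_graph ?T
    by unfold_locales (auto simp: symmetric_def sym_def)
  have "Digraph_Component.connected (with_proj ?T)"
    by (rule connectedI) (auto simp: mk_symmetric_def)
  then show ?thesis
    by unfold_locales (auto simp: cycle_def awalk_def)
qed

text \<open>Removes trees from the problem: it remains to label the vertices injectively so that
  adjacency is read off from label differences. The labels are positions on the spine of a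
  caterpillar, and the label 0 anchors its start.\<close>

lemma interval_PCG_embedding:
  fixes f :: "'a \<Rightarrow> nat" and a b :: "nat \<Rightarrow> real"
  assumes k: "1 \<le> k" and G: "pair_graph G"
    and inj: "inj_on f (pverts G)" and zero: "0 \<in> f ` pverts G"
    and ab: "\<And>j. j \<in> {1..k} \<Longrightarrow> a j \<le> b j"
    and disj: "disjoint_family_on (\<lambda>j. {a j..b j}) {1..k}"
    and edge: "\<And>u v. u \<in> pverts G \<Longrightarrow> v \<in> pverts G \<Longrightarrow> u \<noteq> v \<Longrightarrow>
      (u, v) \<in> parcs G \<longleftrightarrow> (\<exists>j\<in>{1..k}. \<bar>real (f u) - real (f v)\<bar> \<in> {a j..b j})"
  shows "interval_PCG k G"
proof (cases "f ` pverts G = {0}")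
  case True
  then obtain u where u: "pverts G = {u}"
    using inj by (metis card_1_singletonE card_image is_singletonI is_singleton_altdef)
  let ?T = "\<lparr>pverts = {0 :: nat}, parcs = {}\<rparr>"
  have "tree_leaves ?T = {0}"
    by (auto simp: tree_leaves_def)
  then have "bij_betw (\<lambda>_. 0) (pverts G) (tree_leaves ?T)"
    by (simp add: u bij_betw_def)
  then show ?thesis
    unfolding interval_PCG_def
    using k G u ab disj weighted_tree_singleton[of 0 "\<lambda>_. 1"]
    by (intro conjI exI[of _ ?T] exI[of _ "\<lambda>_. 1"] exI[of _ "\<lambda>_. 0"] exI[of _ a] exI[of _ b]) auto
next
  case False
  interpret pair_graph G by (rule G)
  interpret T: nontrivial_caterpillar "f ` pverts G"
    using zero False pair_finite_verts by unfold_locales auto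
  let ?T = "caterpillar (f ` pverts G)" and ?\<zeta> = "\<lambda>u. 2 * f u + 1"
  \<comment> \<open>The shift by 2 accounts for the two pendant edges on every path between
    leaves.\<close>
  let ?a = "\<lambda>j. a j + 2" and ?b = "\<lambda>j. b j + 2"
  have "bij_betw ?\<zeta> (pverts G) (tree_leaves ?T)"
    using inj by (auto simp: bij_betw_def inj_on_def T.tree_leaves_eq)
  moreover have "\<forall>j\<in>{1..k}. ?a j \<le> ?b j"
    using ab by simp
  moreover have "disjoint_family_on (\<lambda>j. {?a j..?b j}) {1..k}"
    unfolding disjoint_family_on_def
  proof (intro ballI impI)
    fix i j assume ij: "i \<in> {1..k}" "j \<in> {1..k}" "i \<noteq> j"
    then have "{a i..b i} \<inter> {a j..b j} = {}"
      using disj by (auto simp: disjoint_family_on_def)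
    then have "x \<notin> {?a i..?b i} \<inter> {?a j..?b j}" for x
      using ab[OF ij(1)] ab[OF ij(2)] by auto
    then show "{?a i..?b i} \<inter> {?a j..?b j} = {}"
      by blast
  qed
  moreover have "(u, v) \<in> parcs G \<longleftrightarrow>
      weighted_tree.tree_dist ?T (\<lambda>_. 1) (?\<zeta> u) (?\<zeta> v) \<in> (\<Union>j\<in>{1..k}. {?a j..?b j})"
    if "u \<in> pverts G" "v \<in> pverts G" "u \<noteq> v" for u v
  proof -
    have "f u \<noteq> f v"
      using inj that by (auto dest: inj_onD)
    then have "weighted_tree.tree_dist ?T (\<lambda>_. 1) (?\<zeta> u) (?\<zeta> v) = \<bar>real (f u) - real (f v)\<bar> + 2"
      using that by (intro T.tree_dist_leaves) auto
    with edge[OF that] show ?thesis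
      by auto
  qed
  ultimately show ?thesis
    unfolding interval_PCG_def
    using k G zero T.weighted_tree_unit
    by (intro conjI exI[of _ ?T] exI[of _ "\<lambda>_. 1"] exI[of _ ?\<zeta>] exI[of _ ?a] exI[of _ ?b]) auto
qed

section \<open>Signed digits in base \<open>N\<close> and the grid weights\<close>

text \<open>Modulo \<open>N\<close> only the lowest digit survives; being smaller than
  \<open>N\<close> in absolute value it is 0. Dividing by \<open>N\<close> removes it, and induction
  handles the rest.\<close>

lemma digits_eq_0:
  fixes N :: int and c :: "nat \<Rightarrow> int"
  assumes "(\<Sum>i\<le>d. c i * N ^ i) = 0" and "\<And>i. i \<le> d \<Longrightarrow> \<bar>c i\<bar> < N" and "i \<le> d"
  shows "c i = 0"
  using assms
proof (induction d arbitrary: c i)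
  case 0
  then show ?case by simp
next
  case (Suc d)
  have split: "c 0 + N * (\<Sum>i\<le>d. c (Suc i) * N ^ i) = 0"
    using Suc.prems(1) unfolding sum.atMost_Suc_shift by (simp add: sum_distrib_left ac_simps)
  then have "N dvd c 0"
    by (metis add_eq_0_iff dvd_minus_iff dvd_triv_left)
  then have c0: "c 0 = 0"
    using Suc.prems(2)[of 0] dvd_imp_le_int by force
  have "N \<noteq> 0"
    using Suc.prems(2)[of 0] by auto
  with split c0 have "(\<Sum>i\<le>d. c (Suc i) * N ^ i) = 0"
    by simp
  then have "c (Suc j) = 0" if "j \<le> d" for j
    using Suc.IH[of "\<lambda>i. c (Suc i)" j] Suc.prems(2) that by simp
  then show ?case
    using c0 Suc.prems(3) by (cases i) auto
qed

text \<open>In base \<open>N\<close> the form with these weights has the digits \<open>z 2, z 1 + z 2, 0, z 3, \<dots>, z d\<close>.\<close>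

definition grid_weight :: "int \<Rightarrow> nat \<Rightarrow> int" where
  "grid_weight N i = (if i = 1 then N else if i = 2 then N + 1 else N ^ i)"

lemma grid_weight_pos: "0 < N \<Longrightarrow> 0 < grid_weight N i"
  by (simp add: grid_weight_def)

text \<open>The bound by half of \<open>N\<close> keeps the digit \<open>z 1 + z 2\<close> below
  \<open>N\<close>. Once all digits vanish, \<open>z 2 = 0\<close> and \<open>z 1 + z 2 = 0\<close>
  give \<open>z 1 = 0\<close>.\<close>

lemma sum_grid_weight_eq_0:
  fixes z :: "nat \<Rightarrow> int"
  assumes "3 \<le> d" and sum: "(\<Sum>i=1..d. grid_weight N i * z i) = 0"
    and bound: "\<And>i. i \<in> {1..d} \<Longrightarrow> 2 * \<bar>z i\<bar> < N" and "i \<in> {1..d}"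
  shows "z i = 0"
proof -
  define c where "c i = (if i = 0 then z 2 else if i = 1 then z 1 + z 2 else if i = 2 then 0 else z i)" for i
  have S: "{..d} = {0,1,2} \<union> {3..d}" "{1..d} = {1,2} \<union> {3..d}"
    using \<open>3 \<le> d\<close> by auto
  have "(\<Sum>i=3..d. c i * N ^ i) = (\<Sum>i=3..d. grid_weight N i * z i)"
    by (rule sum.cong) (auto simp: c_def grid_weight_def)
  then have eq: "(\<Sum>i\<le>d. c i * N ^ i) = (\<Sum>i=1..d. grid_weight N i * z i)"
    unfolding S by (subst (1 2) sum.union_disjoint) (auto simp: c_def grid_weight_def algebra_simps)
  have small: "\<bar>c i\<bar> < N" if "i \<le> d" for i
    using bound[of 1] bound[of 2] bound[of i] \<open>3 \<le> d\<close> that by (auto simp: c_def)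
  have c: "c i = 0" if "i \<le> d" for i
    using digits_eq_0[of c N d i] small sum eq that by simp
  show ?thesis
    using c[of 0] c[of 1] c[of i] assms(1,4) by (auto simp: c_def split: if_splits)
qed

section \<open>Grid graphs, the order of the weights and the choice of intervals\<close>

lemma pair_graph_grid_graph: "pair_graph (grid_graph d n)"
proof unfold_locales
  have V: "finite (grid_verts d n)"
    unfolding grid_verts_def by (intro finite_PiE) auto
  then show "finite (pverts (grid_graph d n))"
    by (simp add: grid_graph_def)
  have "parcs (grid_graph d n) \<subseteq> grid_verts d n \<times> grid_verts d n"
    by (auto simp: grid_graph_def)
  then show "finite (parcs (grid_graph d n))"
    using V by (meson finite_SigmaI finite_subset)
  show "symmetric (with_proj (grid_graph d n))"
    unfolding symmetric_def with_proj_simps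
  proof (rule symI)
    fix x y assume "(x, y) \<in> parcs (grid_graph d n)"
    then obtain i where "x \<in> grid_verts d n" "y \<in> grid_verts d n" "i \<in> {1..d}"
      "\<bar>x i - y i\<bar> = 1" "\<forall>j\<in>{1..d} - {i}. x j = y j"
      by (auto simp: grid_graph_def)
    then show "(y, x) \<in> parcs (grid_graph d n)"
      unfolding grid_graph_def by (auto simp: eq_commute[of "y _"] abs_minus_commute[of "y _"])
  qed
qed (auto simp: grid_graph_def)

text \<open>The comparison of the first two weights with the powers rests on
  \<open>N + 1 < 4 * N\<close> and \<open>4 * N \<le> N ^ 3\<close>, the latter because
  \<open>N \<ge> 2\<close>.\<close>

lemma grid_weight_strict_mono:
  assumes "1 < N" and "1 \<le> i" and "i < j"
  shows "grid_weight N i < grid_weight N j"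
proof (cases "3 \<le> i")
  case True
  with assms show ?thesis
    by (auto simp: grid_weight_def intro: power_strict_increasing)
next
  case False
  then have i: "i = 1 \<or> i = 2"
    using assms(2) by auto
  have "N + 1 < N ^ j" if "3 \<le> j"
  proof -
    have "N + 1 < N * (2 * 2)"
      using \<open>1 < N\<close> by simp
    also have "\<dots> \<le> N * (N * N)"
      using \<open>1 < N\<close> by (intro mult_left_mono mult_mono) auto
    also have "\<dots> = N ^ 3"
      by (simp add: power3_eq_cube)
    also have "\<dots> \<le> N ^ j"
      using that \<open>1 < N\<close> by (intro power_increasing) auto
    finally show ?thesis .
  qed
  with i assms(3) show ?thesis
    by (auto simp: grid_weight_def)
qed

theorem theorem3p1:
  fixes d :: nat and n :: "nat \<Rightarrow> nat"
  assumes "3 \<le> d"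
    and "\<And>i. i \<in> {1..d} \<Longrightarrow> 1 \<le> n i"
  shows "interval_PCG (d - 1) (grid_graph d n)"
proof -
  \<comment> \<open>A single base that exceeds \<open>2 * n i\<close> for every \<open>i\<close>, as
    the digit bound requires.\<close>
  define N :: int where "N = 2 * (\<Sum>i=1..d. int (n i)) + 1"
  let ?V = "grid_verts d n" and ?W = "grid_weight N"
  define L where "L x = (\<Sum>i=1..d. ?W i * x i)" for x
  have n_le: "2 * int (n i) < N" if "i \<in> {1..d}" for i
    using that member_le_sum[of i "{1..d}" "\<lambda>i. int (n i)"] by (simp add: N_def)
  have "1 < N"
    using n_le[of 1] assms(1) assms(2)[of 1] by simp
  have coord: "0 \<le> x i" "x i < int (n i)" if "x \<in> ?V" "i \<in> {1..d}" for x i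
    using that by (auto simp: grid_verts_def PiE_iff)
  have L_nonneg: "0 \<le> L x" if "x \<in> ?V" for x
    unfolding L_def using that coord grid_weight_pos[of N] \<open>1 < N\<close>
    by (intro sum_nonneg mult_nonneg_nonneg) (auto simp: less_imp_le)
  \<comment> \<open>Used with \<open>e = 0\<close> for the injectivity of \<open>L\<close> and with
    \<open>e = 1\<close> and \<open>e = - 1\<close> for the two orientations of an edge in direction
    \<open>i\<close>.\<close>
  have step: "x i - y i = e \<and> (\<forall>j\<in>{1..d} - {i}. x j = y j) \<longleftrightarrow> L x - L y = e * ?W i"
    if "x \<in> ?V" "y \<in> ?V" "i \<in> {1..d}" "\<bar>e\<bar> \<le> 1" for x y i and e :: int
  proof -
    \<comment> \<open>The difference vector minus \<open>e\<close> times the \<open>i\<close>-th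
      unit vector. One side of the equivalence says that it is zero, the other that the linear form
      vanishes on it.\<close>
    let ?z = "\<lambda>j. x j - y j - e * of_bool (j = i)"
    have diff: "L x - L y - e * ?W i = (\<Sum>j=1..d. ?W j * ?z j)"
    proof -
      have "(\<Sum>j=1..d. ?W j * (e * of_bool (j = i))) = e * ?W i"
        using that(3) by (subst sum.remove[of _ i]) (auto intro!: sum.neutral)
      then show ?thesis
        by (simp add: L_def sum_subtractf right_diff_distrib)
    qed
    have small: "2 * \<bar>?z j\<bar> < N" if "j \<in> {1..d}" for j
    proof -
      have bound: "2 * \<bar>u - v\<bar> < N" if "\<bar>u\<bar> + 1 \<le> m" "\<bar>v\<bar> \<le> 1" "2 * m < N" for u v m :: int
        using that by (smt (verit))
      \<comment> \<open>Coordinates range over \<open>n j\<close> consecutive integers, so they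
        differ by at most \<open>n j - 1\<close>; the spare 1 absorbs the correction by
        \<open>e\<close>.\<close>
      have "\<bar>x j - y j\<bar> + 1 \<le> int (n j)"
        using coord[OF \<open>x \<in> ?V\<close> that] coord[OF \<open>y \<in> ?V\<close> that] by linarith
      moreover have "\<bar>e * of_bool (j = i)\<bar> \<le> 1"
        using \<open>\<bar>e\<bar> \<le> 1\<close> by simp
      ultimately show ?thesis
        using n_le[OF that] by (rule bound)
    qed
    show ?thesis
    proof
      assume eq: "x i - y i = e \<and> (\<forall>j\<in>{1..d} - {i}. x j = y j)"
      have "?z j = 0" if "j \<in> {1..d}" for j
        using eq that by (cases "j = i") auto
      then have "(\<Sum>j=1..d. ?W j * ?z j) = 0"
        by (intro sum.neutral) simp
      with diff show "L x - L y = e * ?W i"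
        by simp
    next
      assume "L x - L y = e * ?W i"
      with diff have "(\<Sum>j=1..d. ?W j * ?z j) = 0"
        by simp
      then have z: "?z j = 0" if "j \<in> {1..d}" for j
        using sum_grid_weight_eq_0[OF assms(1), of N ?z j] small that by blast
      have "x j = y j" if "j \<in> {1..d} - {i}" for j
        using z[of j] that by simp
      moreover have "x i - y i = e"
        using z[OF \<open>i \<in> {1..d}\<close>] by simp
      ultimately show "x i - y i = e \<and> (\<forall>j\<in>{1..d} - {i}. x j = y j)"
        by blast
    qed
  qed
  have L_inj: "x = y" if "x \<in> ?V" "y \<in> ?V" "L x = L y" for x y
  proof -
    have "x j = y j" if "j \<in> {1..d}" for j
      using step[OF \<open>x \<in> ?V\<close> \<open>y \<in> ?V\<close> that, of 0] \<open>L x = L y\<close> by simp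
    then show ?thesis
      using that(1,2) unfolding grid_verts_def by (rule PiE_ext[rotated 2])
  qed
  have edge: "(x, y) \<in> parcs (grid_graph d n) \<longleftrightarrow> (\<exists>i\<in>{1..d}. \<bar>L x - L y\<bar> = ?W i)"
    if "x \<in> ?V" "y \<in> ?V" for x y
  proof -
    have "\<bar>x i - y i\<bar> = 1 \<and> (\<forall>j\<in>{1..d} - {i}. x j = y j) \<longleftrightarrow> \<bar>L x - L y\<bar> = ?W i"
      if "i \<in> {1..d}" for i
    proof -
      have "\<bar>L x - L y\<bar> = ?W i \<longleftrightarrow> L x - L y = 1 * ?W i \<or> L x - L y = (- 1) * ?W i"
        using grid_weight_pos[of N i] \<open>1 < N\<close> by linarith
      also have "\<dots> \<longleftrightarrow> (x i - y i = 1 \<or> x i - y i = - 1) \<and> (\<forall>j\<in>{1..d} - {i}. x j = y j)"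
        using step[OF \<open>x \<in> ?V\<close> \<open>y \<in> ?V\<close> that, of 1] step[OF \<open>x \<in> ?V\<close> \<open>y \<in> ?V\<close> that, of "- 1"]
        by auto
      also have "x i - y i = 1 \<or> x i - y i = - 1 \<longleftrightarrow> \<bar>x i - y i\<bar> = 1"
        by linarith
      finally show ?thesis by blast
    qed
    with that show ?thesis
      by (auto simp: grid_graph_def)
  qed
  \<comment> \<open>The \<open>j\<close>-th interval ends at weight \<open>Suc j\<close>. Only the
    first has positive length, from \<open>N\<close> to \<open>N + 1\<close>; every other one is a
    point. This turns \<open>d\<close> weights into \<open>d - 1\<close> intervals.\<close>
  define a where "a j = (if j = 1 then ?W 1 else ?W (Suc j))" for j :: nat
  have mono: "?W i < ?W j" if "1 \<le> i" "i < j" for i j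
    using grid_weight_strict_mono \<open>1 < N\<close> that .
  have a_le: "a j \<le> ?W (Suc j)" if "1 \<le> j" for j
    using mono[of 1 2] by (simp add: a_def numeral_2_eq_2)
  \<comment> \<open>For integers \<open>t\<close>, the first interval contains nothing besides its
    two ends.\<close>
  have mem: "t \<in> {a j..?W (Suc j)} \<longleftrightarrow> t = ?W (Suc j) \<or> j = 1 \<and> t = ?W 1" for t j
    by (auto simp: a_def grid_weight_def)
  have intervals: "(\<exists>i\<in>{1..d}. t = ?W i) \<longleftrightarrow> (\<exists>j\<in>{1..d - 1}. t \<in> {a j..?W (Suc j)})" for t
  proof
    assume "\<exists>i\<in>{1..d}. t = ?W i"
    then obtain i where i: "i \<in> {1..d}" "t = ?W i" ..
    show "\<exists>j\<in>{1..d - 1}. t \<in> {a j..?W (Suc j)}"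
    proof (cases "i = 1")
      case True
      with i assms(1) show ?thesis
        unfolding mem by (intro bexI[of _ 1]) auto
    next
      case False
      with i have "Suc (i - 1) = i" "i - 1 \<in> {1..d - 1}"
        by auto
      with i show ?thesis
        unfolding mem by (intro bexI[of _ "i - 1"]) simp_all
    qed
  next
    assume "\<exists>j\<in>{1..d - 1}. t \<in> {a j..?W (Suc j)}"
    then obtain j where "j \<in> {1..d - 1}" "t = ?W (Suc j) \<or> t = ?W 1"
      unfolding mem by blast
    moreover from this have "Suc j \<in> {1..d}" "1 \<in> {1..d}"
      by auto
    ultimately show "\<exists>i\<in>{1..d}. t = ?W i"
      by blast
  qed
  have separated: "?W (Suc i) < a j" if "1 \<le> i" "i < j" for i j
    using mono[of "Suc i" "Suc j"] that by (simp add: a_def)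
  show ?thesis
  proof (rule interval_PCG_embedding[where f = "\<lambda>x. nat (L x)" and a = "\<lambda>j. of_int (a j)"
        and b = "\<lambda>j. of_int (?W (Suc j))"])
    show "1 \<le> d - 1"
      using assms(1) by simp
    show "pair_graph (grid_graph d n)"
      by (rule pair_graph_grid_graph)
    have V: "pverts (grid_graph d n) = ?V"
      by (simp add: grid_graph_def)
    show "inj_on (\<lambda>x. nat (L x)) (pverts (grid_graph d n))"
      unfolding V using L_inj L_nonneg by (intro inj_onI) (metis int_nat_eq)
    \<comment> \<open>The origin of the grid, made \<open>undefined\<close> outside
      \<open>{1..d}\<close> as \<open>PiE\<close> demands, receives the label 0.\<close>
    have "restrict (\<lambda>_. 0) {1..d} \<in> ?V"
      using assms(2) by (force simp: grid_verts_def)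
    moreover have "nat (L (restrict (\<lambda>_. 0) {1..d})) = 0"
      by (simp add: L_def)
    ultimately show "0 \<in> (\<lambda>x. nat (L x)) ` pverts (grid_graph d n)"
      unfolding V by force
    show "real_of_int (a j) \<le> real_of_int (?W (Suc j))" if "j \<in> {1..d - 1}" for j
      using a_le[of j] that by simp
    show "disjoint_family_on (\<lambda>j. {real_of_int (a j)..real_of_int (?W (Suc j))}) {1..d - 1}"
      unfolding disjoint_family_on_def
    proof (intro ballI impI)
      have disj: "{real_of_int (a i)..real_of_int (?W (Suc i))} \<inter>
          {real_of_int (a j)..real_of_int (?W (Suc j))} = {}" if "1 \<le> i" "i < j" for i j
        using separated[OF that] by auto
      fix i j assume "i \<in> {1..d - 1}" "j \<in> {1..d - 1}" "i \<noteq> j"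
      then show "{real_of_int (a i)..real_of_int (?W (Suc i))} \<inter>
          {real_of_int (a j)..real_of_int (?W (Suc j))} = {}"
        using disj[of i j] disj[of j i] by (cases i j rule: linorder_cases) auto
    qed
    show "(x, y) \<in> parcs (grid_graph d n) \<longleftrightarrow>
        (\<exists>j\<in>{1..d - 1}. \<bar>real (nat (L x)) - real (nat (L y))\<bar> \<in>
          {real_of_int (a j)..real_of_int (?W (Suc j))})"
      if "x \<in> pverts (grid_graph d n)" "y \<in> pverts (grid_graph d n)" "x \<noteq> y" for x y
    proof -
      \<comment> \<open>Labels are nonnegative, so \<open>nat\<close> preserves them, and the real
        difference is an integer to which \<open>edge\<close> and \<open>intervals\<close>
        apply.\<close>
      have "\<bar>real (nat (L x)) - real (nat (L y))\<bar> = real_of_int \<bar>L x - L y\<bar>"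
        using L_nonneg that(1,2) by (simp add: V)
      then show ?thesis
        using edge[of x y] intervals[of "\<bar>L x - L y\<bar>"] that(1,2)
        by (simp only: V atLeastAtMost_iff of_int_le_iff)
    qed
  qed
qed

end
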